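(* Consider the game with shared equality constraint set $X=X^e$ described in the context and let Assumptions 1 and 2 (as stated in the context) hold. Let $\rho\in[1,2)$, let $\{\mu_k\}$ be a nonnegative sequence with $\sum_{k=1}^\infty\mu_k<\infty$, and let $R_i,H_i,W_l$ be symmetric positive definite. Let $col(\mathbf x_k,\mathbf Z_k,\bar\lambda_k)$ be any sequence generated by Algorithm 1 (described in the context) from initial points $\mathbf x_0,\mathbf Z_0,\bar\lambda_0$. Then there exist a nonnegative sequence $\{\nu_k\}$ with $\sum_{k=1}^\infty\nu_k<\infty$ and sequences $\varpi_k=col(\mathbf x'_k,\eta_k,\mathbf Z'_k,\theta_k)$, $\hat\varpi_k$, $\tilde\varpi_k$ satisfying, for all $k\ge0$, the inexact preconditioned proximal point recursion with operator $\bar{\mathfrak M}^e$ and preconditioning matrix $\Phi^e$, $$\Phi^e(\varpi_k-\hat\varpi_k)\in\bar{\mathfrak M}^e\hat\varpi_k,\qquad\|\hat\varpi_k-\tilde\varpi_k\|\le\nu_k,\qquad\varpi_{k+1}=\varpi_k+\rho(\tilde\varpi_k-\varpi_k),$$ with initial points $\mathbf x'_0=\mathbf x_0$, $\eta_0=\bar\lambda_0+H(\Lambda\mathbf x_0+\bar V\mathbf Z_0-\bar b)$, $\mathbf Z'_0=\mathbf Z_0$, $\theta_0=\mathbf 0$, such that for all $k\ge0$ $$\mathbf x_k=\mathbf x'_k,\qquad\mathbf Z_k=\mathbf Z'_k,\qquad\bar\lambda_k=\eta_k-\theta_k-H(\Lambda\mathbf x'_k+\bar V\mathbf Z'_k-\bar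 b).$$
   Context: Notation. $col(\cdot)$ is the stacked column vector, $diag\{\cdot\}$ the block diagonal matrix, $\|x\|_G^2=x^TGx$ for symmetric $G$, $\|\cdot\|$ the Euclidean norm, $\otimes$ the Kronecker product. For a closed convex set $\Omega$, $N_\Omega(x)=\{v:\langle v,y-x\rangle\le0\ \forall y\in\Omega\}$ for $x\in\Omega$ (empty otherwise). "l.s.c. function" means lower semicontinuous convex function; its subdifferential at $x\in dom f$ is $\partial f(x)=\{g:f(y)\ge f(x)+\langle g,y-x\rangle\ \forall y\in dom f\}$. Game. Players $\mathcal N=\{1,\dots,N\}$; player $i$ chooses $x_i\in\Omega_i\subset\mathbf R^{n_i}$; $n=\sum_in_i$, $\mathbf x=col(x_1,\dots,x_N)\in\mathbf R^n$, $\mathbf x_{-i}$ is the profile of all players except $i$, $\bar\Omega=\prod_{i=1}^N\Omega_i$. Player $i$ has objective $f_i(x_i,\mathbf x_{-i}):\bar\Omega\to\mathbf R$, $A_i\in\mathbf R^{m\times n_i}$, $b_i\in\mathbf R^m$. The shared set is $X=X^e:=\bar\Omega\cap\{\mathbf x:\sum_{i=1}^NA_ix_i=\sum_{i=1}^Nb_i\}$, and $X_i(\mathbf x_{-i})=\{x_i\in\Omega_i:(x_i,\mathbf x_{-i})\in X\}$. Player $i$ minimizes $f_i(x_i,\mathbf x_{-i})$ over $x_i\in X_i(\mathbf x_{-i})$. With $\partial_if_i(x_i,\mathbf x_{-i})$ the subdifferential in $x_i$, the pseudo-subdifferential is $\partial F(\mathbf x)=\prod_{i=1}^N\partial_if_i(x_i,\mathbf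 x_{-i})$. The generalized variational inequality (GVI) is: find $\mathbf x^*\in X$ for which there is $l^*\in\partial F(\mathbf x^* )$ with $\langle l^*,\mathbf x-\mathbf x^*\rangle\ge0$ for all $\mathbf x\in X$. Assumption 1. For each $i$, $f_i(\cdot,\mathbf x_{-i})$ is a proper l.s.c. (convex) function for every fixed $\mathbf x_{-i}$; $\partial F$ is maximally monotone; each $\Omega_i$ is closed convex with nonempty interior; $X^e$ has nonempty relative interior; $X_i(\mathbf x_{-i})$ has nonempty relative interior for every $\mathbf x_{-i}\in\prod_{j\ne i}\Omega_j$. Assumption 2. The GVI has at least one solution. Graph. $\mathcal G=(\mathcal N,\mathcal E)$ is a connected undirected graph with $M$ edges $e_1,\dots,e_M$, each given an arbitrary orientation $i\to j$. $\mathcal E_i^{in}$ (resp. $\mathcal E_i^{out}$) is the set of edges with target (resp. start) $i$, $\mathcal E_i=\mathcal E_i^{in}\cup\mathcal E_i^{out}$. The incidence matrix $V\in\mathbf R^{N\times M}$ has $V_{il}=1$ if $e_l\in\mathcal E_i^{in}$, $-1$ if $e_l\in\mathcal E_i^{out}$, $0$ otherwise. Compact notation. $\lambda_i\in\mathbf R^m$ is the local multiplier of player $i$, $z_l\in\mathbf R^m$ the variable of edge $e_l$; $\bar\lambda=col(\lambda_1,\dots,\lambda_N)$, $\mathbf Z=col(z_1,\dots,z_M)$, $R=diag\{R_1,\dots,R_N\}$ with $R_i\in\mathbf R^{n_i\times n_i}$, $H=diag\{H_1,\dots,H_N\}$ with $H_i\in\mathbf R^{m\times m}$, $W=diag\{W_1,\dots,W_M\}$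 with $W_l\in\mathbf R^{m\times m}$, $\bar V=V\otimes I_m$, $\Lambda=diag\{A_1,\dots,A_N\}$, $\bar b=col(b_1,\dots,b_N)$. Algorithm 1. From initial $\mathbf x_0,\mathbf Z_0,\bar\lambda_0$, for $k=0,1,\dots$: Step 1: let $\hat{\mathbf x}_k$ be the (unique) Nash equilibrium of the subgame in which player $i$ minimizes over $x_i\in\Omega_i$ the function $$\tilde f_i(x_i,\mathbf x_{-i})=f_i(x_i,\mathbf x_{-i})+\tfrac12\|x_i-x_{i,k}\|_{R_i}^2+\Big[\lambda_{i,k}+H_i\Big(A_ix_{i,k}+\sum_{l\in\mathcal E_i}V_{il}z_{l,k}-b_i\Big)\Big]^TA_ix_i;$$ choose any $\tilde{\mathbf x}_k=col(\tilde x_{1,k},\dots,\tilde x_{N,k})$ with $\|\tilde{\mathbf x}_k-\hat{\mathbf x}_k\|\le\mu_k$; set $x_{i,k+1}=x_{i,k}+\rho(\tilde x_{i,k}-x_{i,k})$. Step 2: $\lambda_{i,k+1}=\lambda_{i,k}+\rho H_i(A_i\tilde x_{i,k}+\sum_{l\in\mathcal E_i}V_{il}z_{l,k}-b_i)$. Step 3: let $s_{i,k}=\frac1\rho\lambda_{i,k+1}+\frac{\rho-1}{\rho}\lambda_{i,k}+H_i(A_i\tilde x_{i,k}+\sum_{l\in\mathcal E_i}V_{il}z_{l,k}-b_i)$; for each edge $e_l=i\to j$ set $z_{l,k+1}=z_{l,k}-\rho W_l(s_{j,k}-s_{i,k})$. Augmented operator and preconditioner. For $\varpi=col(\mathbf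 x,\eta,\mathbf Z,\theta)$ with $\eta,\theta\in\mathbf R^{mN}$, $$\bar{\mathfrak M}^e:\varpi\mapsto\begin{pmatrix}\mathbf0&\Lambda^T&\mathbf0&-\Lambda^T\\-\Lambda&\mathbf0&-\bar V&\mathbf0\\\mathbf0&\bar V^T&\mathbf0&-\bar V^T\\\Lambda&\mathbf0&\bar V&\mathbf0\end{pmatrix}\varpi+\begin{pmatrix}(N_{\bar\Omega}+\partial F)\mathbf x\\\bar b\\\mathbf0\\-\bar b\end{pmatrix},\qquad\Phi^e=\begin{pmatrix}R&-\Lambda^T&\mathbf0&\Lambda^T\\-\Lambda&2H^{-1}&\bar V&\mathbf0\\\mathbf0&\bar V^T&W^{-1}&\bar V^T\\\Lambda&\mathbf0&\bar V&2H^{-1}\end{pmatrix}.$$ *)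

theory Defs
  imports "Graph_Theory.Digraph_Component" "HOL-Analysis.Analysis"
begin

section \<open>Convex analysis\<close>

text \<open>Lower semicontinuity and the subdifferential of a function with effective domain \<open>S\<close>
  (that is, extended by plus infinity outside \<open>S\<close>). The argument \<open>E\<close> of \<open>subdifferential\<close>
  is the linear space in which the subgradients live.\<close>

definition lsc_on :: "'a::topological_space set \<Rightarrow> ('a \<Rightarrow> real) \<Rightarrow> bool" where
  "lsc_on S f \<longleftrightarrow> (\<forall>x\<in>S. ereal (f x) \<le> Liminf (at x within S) (\<lambda>y. ereal (f y)))"

definition proper_lsc_convex :: "'a::real_normed_vector set \<Rightarrow> ('a \<Rightarrow> real) \<Rightarrow> bool" where
  "proper_lsc_convex S f \<longleftrightarrow> S \<noteq> {} \<and> lsc_on S f \<and> convex_on S f"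

definition subdifferential ::
    "'a::real_inner set \<Rightarrow> 'a set \<Rightarrow> ('a \<Rightarrow> real) \<Rightarrow> 'a \<Rightarrow> 'a set" where
  "subdifferential E S f x = (if x \<in> S then {g \<in> E. \<forall>y\<in>S. f y \<ge> f x + g \<bullet> (y - x)} else {})"

definition normal_cone :: "'a::real_inner set \<Rightarrow> 'a \<Rightarrow> 'a set" where
  "normal_cone S x = (if x \<in> S then {v. \<forall>y\<in>S. v \<bullet> (y - x) \<le> 0} else {})"

definition monotone_op :: "('a::real_inner \<Rightarrow> 'a set) \<Rightarrow> bool" where
  "monotone_op T \<longleftrightarrow> (\<forall>x y. \<forall>u\<in>T x. \<forall>v\<in>T y. (x - y) \<bullet> (u - v) \<ge> 0)"

definition maximal_monotone_op :: "('a::real_inner \<Rightarrow> 'a set) \<Rightarrow> bool" where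
  "maximal_monotone_op T \<longleftrightarrow>
     monotone_op T \<and> (\<forall>S. monotone_op S \<and> (\<forall>x. T x \<subseteq> S x) \<longrightarrow> S = T)"


section \<open>Matrices\<close>

text \<open>Symmetry and positive definiteness of the quadratic form of \<open>M\<close> on a subspace \<open>E\<close>;
  \<open>E = UNIV\<close> is the usual notion.\<close>

definition sym_pos_def_on :: "(real^'n) set \<Rightarrow> real^'n^'n \<Rightarrow> bool" where
  "sym_pos_def_on E M \<longleftrightarrow>
     (\<forall>u\<in>E. \<forall>v\<in>E. u \<bullet> (M *v v) = (M *v u) \<bullet> v) \<and> (\<forall>v\<in>E. v \<noteq> 0 \<longrightarrow> v \<bullet> (M *v v) > 0)"

definition kron :: "real^'b^'a \<Rightarrow> real^'d^'c \<Rightarrow> real^('b \<times> 'd)^('a \<times> 'c)" where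
  "kron P Q = (\<chi> r s. P $ fst r $ fst s * Q $ snd r $ snd s)"

definition block_diag :: "('i::finite \<Rightarrow> real^'m^'m) \<Rightarrow> real^('i \<times> 'm)^('i \<times> 'm)" where
  "block_diag B = (\<chi> r s. if fst r = fst s then B (fst r) $ snd r $ snd s else 0)"

definition col :: "('i::finite \<Rightarrow> real^'m) \<Rightarrow> real^('i \<times> 'm)" where
  "col v = (\<chi> r. v (fst r) $ snd r)"


section \<open>Games with a shared affine equality constraint\<close>

text \<open>The type \<open>'c\<close> indexes all \<open>n\<close> scalar coordinates of a profile, and \<open>owner\<close> assigns each
  coordinate to a player; player \<open>i\<close> owns \<open>n\<^sub>i\<close> of them. The space of player \<open>i\<close> is identified
  with the coordinate subspace \<open>player_space \<Gamma> i\<close> of \<open>real^'c\<close>, so that the \<open>n\<^sub>i\<close> may differ.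
  Of the matrix \<open>constr_mat \<Gamma> i\<close> only the \<open>n\<^sub>i\<close> columns owned by \<open>i\<close> are ever used, and of
  \<open>cost \<Gamma> i\<close> only the values on the product of the strategy sets.\<close>

record ('p, 'c::finite, 'm::finite) shared_game =
  owner :: "'c \<Rightarrow> 'p"
  strat :: "'p \<Rightarrow> (real^'c) set"
  cost :: "'p \<Rightarrow> real^'c \<Rightarrow> real"
  constr_mat :: "'p \<Rightarrow> real^'c^'m"
  constr_rhs :: "'p \<Rightarrow> real^'m"

definition player_space :: "('p, 'c::finite, 'm::finite) shared_game \<Rightarrow> 'p \<Rightarrow> (real^'c) set" where
  "player_space \<Gamma> i = {v. \<forall>j. owner \<Gamma> j \<noteq> i \<longrightarrow> v $ j = 0}"

definition block :: "('p, 'c::finite, 'm::finite) shared_game \<Rightarrow> 'p \<Rightarrow> real^'c \<Rightarrow> real^'c" where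
  "block \<Gamma> i x = (\<chi> j. if owner \<Gamma> j = i then x $ j else 0)"

text \<open>\<open>subst_block \<Gamma> i y x\<close> is the profile \<open>(y, x\<^sub>-\<^sub>i)\<close>; the block \<open>i\<close> of \<open>x\<close> is irrelevant,
  so \<open>x\<close> also serves as a representation of the profile \<open>x\<^sub>-\<^sub>i\<close> of the other players.\<close>

definition subst_block ::
    "('p, 'c::finite, 'm::finite) shared_game \<Rightarrow> 'p \<Rightarrow> real^'c \<Rightarrow> real^'c \<Rightarrow> real^'c" where
  "subst_block \<Gamma> i y x = (\<chi> j. if owner \<Gamma> j = i then y $ j else x $ j)"

definition strat_prod :: "('p, 'c::finite, 'm::finite) shared_game \<Rightarrow> (real^'c) set" where
  "strat_prod \<Gamma> = {x. \<forall>i. block \<Gamma> i x \<in> strat \<Gamma> i}"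

definition shared_set :: "('p::finite, 'c::finite, 'm::finite) shared_game \<Rightarrow> (real^'c) set" where
  "shared_set \<Gamma> = strat_prod \<Gamma> \<inter>
     {x. (\<Sum>i\<in>UNIV. constr_mat \<Gamma> i *v block \<Gamma> i x) = (\<Sum>i\<in>UNIV. constr_rhs \<Gamma> i)}"

definition feasible_resp ::
    "('p::finite, 'c::finite, 'm::finite) shared_game \<Rightarrow> 'p \<Rightarrow> real^'c \<Rightarrow> (real^'c) set" where
  "feasible_resp \<Gamma> i x = {y \<in> strat \<Gamma> i. subst_block \<Gamma> i y x \<in> shared_set \<Gamma>}"

definition pseudo_subdiff ::
    "('p, 'c::finite, 'm::finite) shared_game \<Rightarrow> real^'c \<Rightarrow> (real^'c) set" where
  "pseudo_subdiff \<Gamma> x = {l. \<forall>i. block \<Gamma> i l \<in>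
     subdifferential (player_space \<Gamma> i) (strat \<Gamma> i)
       (\<lambda>y. cost \<Gamma> i (subst_block \<Gamma> i y x)) (block \<Gamma> i x)}"

definition gvi_solution :: "('p::finite, 'c::finite, 'm::finite) shared_game \<Rightarrow> real^'c \<Rightarrow> bool" where
  "gvi_solution \<Gamma> x \<longleftrightarrow> x \<in> shared_set \<Gamma> \<and>
     (\<exists>l\<in>pseudo_subdiff \<Gamma> x. \<forall>y\<in>shared_set \<Gamma>. l \<bullet> (y - x) \<ge> 0)"

definition regular_game :: "('p::finite, 'c::finite, 'm::finite) shared_game \<Rightarrow> bool" where
  "regular_game \<Gamma> \<longleftrightarrow>
     (\<forall>i. strat \<Gamma> i \<subseteq> player_space \<Gamma> i \<and> closed (strat \<Gamma> i) \<and> convex (strat \<Gamma> i) \<and>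
        (top_of_set (player_space \<Gamma> i)) interior_of (strat \<Gamma> i) \<noteq> {}) \<and>
     (\<forall>i x. (\<forall>j. j \<noteq> i \<longrightarrow> block \<Gamma> j x \<in> strat \<Gamma> j) \<longrightarrow>
        proper_lsc_convex (strat \<Gamma> i) (\<lambda>y. cost \<Gamma> i (subst_block \<Gamma> i y x))) \<and>
     maximal_monotone_op (pseudo_subdiff \<Gamma>) \<and>
     rel_interior (shared_set \<Gamma>) \<noteq> {} \<and>
     (\<forall>i x. (\<forall>j. j \<noteq> i \<longrightarrow> block \<Gamma> j x \<in> strat \<Gamma> j) \<longrightarrow>
        rel_interior (feasible_resp \<Gamma> i x) \<noteq> {})"

text \<open>Nash equilibrium of the game with strategy sets \<open>strat \<Gamma> i\<close> (no shared constraint) and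
  cost functions \<open>g i\<close>.\<close>

definition nash_equilibrium ::
    "('p, 'c::finite, 'm::finite) shared_game \<Rightarrow> ('p \<Rightarrow> real^'c \<Rightarrow> real) \<Rightarrow> real^'c \<Rightarrow> bool" where
  "nash_equilibrium \<Gamma> g x \<longleftrightarrow>
     (\<forall>i. block \<Gamma> i x \<in> strat \<Gamma> i \<and> (\<forall>y\<in>strat \<Gamma> i. g i x \<le> g i (subst_block \<Gamma> i y x)))"


section \<open>Communication graph\<close>

text \<open>The undirected graph is given together with an orientation of its edges; connectedness
  ignores the orientation. The edge set \<open>arcs G\<close> may be empty (one player), hence it need not
  be all of the type \<open>'e\<close>: the vectors stacked over the edges are the elements of
  \<open>real^('e \<times> 'm)\<close> that vanish outside \<open>arcs G\<close>.\<close>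

definition comm_graph :: "('p, 'e) pre_digraph \<Rightarrow> bool" where
  "comm_graph G \<longleftrightarrow> fin_digraph G \<and> loopfree_digraph G \<and> verts G = UNIV \<and>
     Digraph_Component.connected G"

definition incident_arcs :: "('p::finite, 'e::finite) pre_digraph \<Rightarrow> 'p \<Rightarrow> 'e set" where
  "incident_arcs G i = in_arcs G i \<union> out_arcs G i"

definition incidence :: "('p::finite, 'e::finite) pre_digraph \<Rightarrow> real^'e^'p" where
  "incidence G = (\<chi> i l. if l \<in> in_arcs G i then 1 else if l \<in> out_arcs G i then -1 else 0)"

definition edge_space :: "('p::finite, 'e::finite) pre_digraph \<Rightarrow> (real^('e \<times> 'm::finite)) set" where
  "edge_space G = {Z. \<forall>l a. l \<notin> arcs G \<longrightarrow> Z $ (l, a) = 0}"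

definition edge_col ::
    "('p::finite, 'e::finite) pre_digraph \<Rightarrow> ('e \<Rightarrow> real^'m::finite) \<Rightarrow> real^('e \<times> 'm)" where
  "edge_col G z = col (\<lambda>l. if l \<in> arcs G then z l else 0)"


section \<open>The distributed algorithm\<close>

definition local_residual ::
    "('p, 'c::finite, 'm::finite) shared_game \<Rightarrow> ('p::finite, 'e::finite) pre_digraph \<Rightarrow>
     real^'c \<Rightarrow> ('e \<Rightarrow> real^'m) \<Rightarrow> 'p \<Rightarrow> real^'m" where
  "local_residual \<Gamma> G x z i = constr_mat \<Gamma> i *v block \<Gamma> i x
     + (\<Sum>l\<in>incident_arcs G i. incidence G $ i $ l *\<^sub>R z l) - constr_rhs \<Gamma> i"

definition subgame_cost ::
    "('p, 'c::finite, 'm::finite) shared_game \<Rightarrow> ('p::finite, 'e::finite) pre_digraph \<Rightarrow>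
     ('p \<Rightarrow> real^'c^'c) \<Rightarrow> ('p \<Rightarrow> real^'m^'m) \<Rightarrow>
     real^'c \<Rightarrow> ('e \<Rightarrow> real^'m) \<Rightarrow> ('p \<Rightarrow> real^'m) \<Rightarrow> 'p \<Rightarrow> real^'c \<Rightarrow> real" where
  "subgame_cost \<Gamma> G R H xk zk lamk i x =
     cost \<Gamma> i x
     + 1/2 * (block \<Gamma> i (x - xk) \<bullet> (R i *v block \<Gamma> i (x - xk)))
     + (lamk i + H i *v local_residual \<Gamma> G xk zk i) \<bullet> (constr_mat \<Gamma> i *v block \<Gamma> i x)"

definition generated_by_algorithm ::
    "('p, 'c::finite, 'm::finite) shared_game \<Rightarrow> ('p::finite, 'e::finite) pre_digraph \<Rightarrow>
     ('p \<Rightarrow> real^'c^'c) \<Rightarrow> ('p \<Rightarrow> real^'m^'m) \<Rightarrow> ('e \<Rightarrow> real^'m^'m) \<Rightarrow>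
     real \<Rightarrow> (nat \<Rightarrow> real) \<Rightarrow>
     (nat \<Rightarrow> real^'c) \<Rightarrow> (nat \<Rightarrow> 'e \<Rightarrow> real^'m) \<Rightarrow> (nat \<Rightarrow> 'p \<Rightarrow> real^'m) \<Rightarrow> bool" where
  "generated_by_algorithm \<Gamma> G R H W \<rho> \<mu> x z lam \<longleftrightarrow>
     (\<exists>xhat xtil s. \<forall>k.
        nash_equilibrium \<Gamma> (subgame_cost \<Gamma> G R H (x k) (z k) (lam k)) (xhat k) \<and>
        norm (xtil k - xhat k) \<le> \<mu> k \<and>
        x (Suc k) = x k + \<rho> *\<^sub>R (xtil k - x k) \<and>
        (\<forall>i. lam (Suc k) i = lam k i + \<rho> *\<^sub>R (H i *v local_residual \<Gamma> G (xtil k) (z k) i)) \<and>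
        (\<forall>i. s k i = (1 / \<rho>) *\<^sub>R lam (Suc k) i + ((\<rho> - 1) / \<rho>) *\<^sub>R lam k i
                      + H i *v local_residual \<Gamma> G (xtil k) (z k) i) \<and>
        (\<forall>l\<in>arcs G. z (Suc k) l = z k l - \<rho> *\<^sub>R (W l *v (s k (head G l) - s k (tail G l)))))"


section \<open>Augmented operator and preconditioner\<close>

definition LambdaM :: "('p::finite, 'c::finite, 'm::finite) shared_game \<Rightarrow> real^'c^('p \<times> 'm)" where
  "LambdaM \<Gamma> = (\<chi> r j. if owner \<Gamma> j = fst r then constr_mat \<Gamma> (fst r) $ snd r $ j else 0)"

definition Vbar :: "('p::finite, 'e::finite) pre_digraph \<Rightarrow> real^('e \<times> 'm::finite)^('p \<times> 'm)" where
  "Vbar G = kron (incidence G) (mat 1)"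

definition bbar :: "('p::finite, 'c::finite, 'm::finite) shared_game \<Rightarrow> real^('p \<times> 'm)" where
  "bbar \<Gamma> = col (constr_rhs \<Gamma>)"

definition RM ::
    "('p, 'c::finite, 'm::finite) shared_game \<Rightarrow> ('p \<Rightarrow> real^'c^'c) \<Rightarrow> real^'c^'c" where
  "RM \<Gamma> R = (\<chi> j k. if owner \<Gamma> j = owner \<Gamma> k then R (owner \<Gamma> j) $ j $ k else 0)"

text \<open>The identity blocks at indices outside \<open>arcs G\<close> make this matrix invertible on the whole
  type; on \<open>edge_space G\<close> its inverse is the inverse of the block diagonal matrix over the
  edges.\<close>

definition WM ::
    "('p::finite, 'e::finite) pre_digraph \<Rightarrow> ('e \<Rightarrow> real^'m^'m) \<Rightarrow> real^('e \<times> 'm)^('e \<times> 'm)" where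
  "WM G W = block_diag (\<lambda>l. if l \<in> arcs G then W l else mat 1)"

type_synonym ('p, 'c, 'e, 'm) aug_state =
  "(real^'c) \<times> (real^('p \<times> 'm)) \<times> (real^('e \<times> 'm)) \<times> (real^('p \<times> 'm))"

definition aug_space ::
    "('p::finite, 'e::finite) pre_digraph \<Rightarrow> ('p, 'c::finite, 'e, 'm::finite) aug_state set" where
  "aug_space G = UNIV \<times> UNIV \<times> edge_space G \<times> UNIV"

fun aug_op ::
    "('p::finite, 'c::finite, 'm::finite) shared_game \<Rightarrow> ('p, 'e::finite) pre_digraph \<Rightarrow>
     ('p, 'c, 'e, 'm) aug_state \<Rightarrow> ('p, 'c, 'e, 'm) aug_state set" where
  "aug_op \<Gamma> G (x, \<eta>, Z, \<theta>) =
     {(transpose (LambdaM \<Gamma>) *v \<eta> - transpose (LambdaM \<Gamma>) *v \<theta> + (u + v),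
       - (LambdaM \<Gamma> *v x) - Vbar G *v Z + bbar \<Gamma>,
       transpose (Vbar G) *v \<eta> - transpose (Vbar G) *v \<theta>,
       LambdaM \<Gamma> *v x + Vbar G *v Z - bbar \<Gamma>) | u v.
       u \<in> normal_cone (strat_prod \<Gamma>) x \<and> v \<in> pseudo_subdiff \<Gamma> x}"

fun precond ::
    "('p::finite, 'c::finite, 'm::finite) shared_game \<Rightarrow> ('p, 'e::finite) pre_digraph \<Rightarrow>
     ('p \<Rightarrow> real^'c^'c) \<Rightarrow> ('p \<Rightarrow> real^'m^'m) \<Rightarrow> ('e \<Rightarrow> real^'m^'m) \<Rightarrow>
     ('p, 'c, 'e, 'm) aug_state \<Rightarrow> ('p, 'c, 'e, 'm) aug_state" where
  "precond \<Gamma> G R H W (x, \<eta>, Z, \<theta>) =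
     (RM \<Gamma> R *v x - transpose (LambdaM \<Gamma>) *v \<eta> + transpose (LambdaM \<Gamma>) *v \<theta>,
      - (LambdaM \<Gamma> *v x) + 2 *\<^sub>R (matrix_inv (block_diag H) *v \<eta>) + Vbar G *v Z,
      transpose (Vbar G) *v \<eta> + matrix_inv (WM G W) *v Z + transpose (Vbar G) *v \<theta>,
      LambdaM \<Gamma> *v x + Vbar G *v Z + 2 *\<^sub>R (matrix_inv (block_diag H) *v \<theta>))"

definition inexact_ppp ::
    "('p::finite, 'c::finite, 'm::finite) shared_game \<Rightarrow> ('p, 'e::finite) pre_digraph \<Rightarrow>
     ('p \<Rightarrow> real^'c^'c) \<Rightarrow> ('p \<Rightarrow> real^'m^'m) \<Rightarrow> ('e \<Rightarrow> real^'m^'m) \<Rightarrow>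
     real \<Rightarrow> (nat \<Rightarrow> real) \<Rightarrow> (nat \<Rightarrow> ('p, 'c, 'e, 'm) aug_state) \<Rightarrow>
     (nat \<Rightarrow> ('p, 'c, 'e, 'm) aug_state) \<Rightarrow> (nat \<Rightarrow> ('p, 'c, 'e, 'm) aug_state) \<Rightarrow> bool" where
  "inexact_ppp \<Gamma> G R H W \<rho> \<nu> w what wtil \<longleftrightarrow>
     (\<forall>k. w k \<in> aug_space G \<and> what k \<in> aug_space G \<and> wtil k \<in> aug_space G \<and>
        precond \<Gamma> G R H W (w k - what k) \<in> aug_op \<Gamma> G (what k) \<and>
        norm (what k - wtil k) \<le> \<nu> k \<and>
        w (Suc k) = w k + \<rho> *\<^sub>R (wtil k - w k))"

end

theory Submission
  imports Defs
begin

text \<open>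
  The rows of the proximal inclusion \<open>\<Phi>(w - w') \<in> M w'\<close> can be solved one after the other.
  Write \<open>w = (x, \<eta>, Z, \<theta>)\<close> and \<open>w' = (\<xi>, \<eta>', Y, \<theta>')\<close>, and let \<open>\<Lambda>\<close>, \<open>V\<close>, \<open>b\<close>, \<open>H\<close>, \<open>W\<close>, \<open>R\<close>
  be the stacked data. The preconditioner cancels the unknown multipliers \<open>\<eta>'\<close>, \<open>\<theta>'\<close> from the
  first row, which becomes
  \<open>R(x - \<xi>) - \<Lambda>\<^sup>T(\<eta> - \<theta>) \<in> (N + \<partial>F)(\<xi>)\<close>. Given \<open>\<xi>\<close>, the second row yields \<open>\<eta>'\<close>, the third then
  yields \<open>Y\<close>, and the fourth yields \<open>\<theta>'\<close>, each by an affine formula. The map \<open>aug_step\<close>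
  collects these formulas, as a function of the old state and of \<open>\<xi>\<close>, and
  \<open>precond_aug_step_in_aug_op\<close> says that it solves the inclusion once \<open>\<xi>\<close> solves the first row.

  The algorithm keeps only one multiplier,
  \<open>\<lambda> = \<eta> - \<theta> - H(\<Lambda> x + V Z - b)\<close>. Under this substitution the first row is the joint first-order
  condition of the subgame in which the players minimize their regularized costs, so its
  solution \<open>\<xi>\<close> is the Nash equilibrium (\<open>nash_equilibrium_subgradient\<close>). If the equilibrium is
  replaced by an arbitrary point \<open>\<xi>\<close>, one relaxed step \<open>w + \<rho>(aug_step w \<xi> - w)\<close> still changes
  \<open>x\<close>, \<open>Z\<close> and \<open>\<lambda>\<close> exactly as the algorithm does with the strategy \<open>\<xi>\<close> (\<open>relaxed_aug_step\<close>,
  \<open>algorithm_update_stacked\<close>); the vector \<open>s\<close> that neighbours exchange is \<open>\<eta>' + \<eta>' - \<eta> - \<theta>\<close>.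

  Hence the iteration with the approximate equilibria as \<open>\<xi>\<close> reproduces the algorithm, and the
  exact proximal points are obtained by inserting the exact equilibria instead. Since \<open>aug_step\<close>
  is affine in \<open>\<xi>\<close>, uniformly in the state, the error of the proximal step is at most a constant
  times the error of the equilibrium (\<open>aug_step_lipschitz\<close>), which preserves summability.
\<close>

section \<open>Stacked vectors and block matrices\<close>

lemma sum_prod_UNIV:
  fixes f :: "'a::finite \<times> 'b::finite \<Rightarrow> 'd::comm_monoid_add"
  shows "(\<Sum>s\<in>UNIV. f s) = (\<Sum>i\<in>UNIV. \<Sum>a\<in>UNIV. f (i, a))"
  by (simp add: sum.cartesian_product)

lemma sum_kronecker_delta:
  fixes f :: "'a::finite \<Rightarrow> real"
  shows "(\<Sum>c\<in>UNIV. p * (if c = a then 1 else 0) * f c) = p * f a"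
    and "(\<Sum>c\<in>UNIV. p * (if a = c then 1 else 0) * f c) = p * f a"
proof -
  have "(\<Sum>c\<in>UNIV. p * (if c = a then 1 else 0) * f c) = (\<Sum>c\<in>UNIV. if c = a then p * f c else 0)"
    by (intro sum.cong) auto
  then show "(\<Sum>c\<in>UNIV. p * (if c = a then 1 else 0) * f c) = p * f a" by simp
  then show "(\<Sum>c\<in>UNIV. p * (if a = c then 1 else 0) * f c) = p * f a" by (simp add: eq_commute)
qed

lemma col_nth [simp]: "col v $ (i, a) = v i $ a"
  by (simp add: col_def)

lemma col_cases: obtains v where "p = col v"
proof
  show "p = col (\<lambda>i. \<chi> a. p $ (i, a))"
    by (simp add: col_def vec_eq_iff)
qed

lemma col_eq_iff: "col u = col v \<longleftrightarrow> u = v"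
  by (auto simp: vec_eq_iff fun_eq_iff)

lemma col_add: "col u + col v = col (\<lambda>i. u i + v i)"
  by (simp add: vec_eq_iff)

lemma col_diff: "col u - col v = col (\<lambda>i. u i - v i)"
  by (simp add: vec_eq_iff)

lemma col_scaleR: "c *\<^sub>R col u = col (\<lambda>i. c *\<^sub>R u i)"
  by (simp add: vec_eq_iff)

lemma edge_col_nth [simp]: "edge_col G z $ (l, a) = (if l \<in> arcs G then z l $ a else 0)"
  by (simp add: edge_col_def)

lemma edge_col_in_edge_space: "edge_col G z \<in> edge_space G"
  by (simp add: edge_space_def)

lemma block_diag_mult_col: "block_diag B *v col v = col (\<lambda>i. B i *v v i)"
proof -
  have "(block_diag B *v col v) $ (i, a) = (B i *v v i) $ a" for i a
  proof -
    have "(block_diag B *v col v) $ (i, a)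
        = (\<Sum>j\<in>UNIV. if j = i then (B i *v v i) $ a else 0)"
      by (simp add: block_diag_def matrix_vector_mult_def sum_prod_UNIV del: sum.delta sum.delta')
        (intro sum.cong refl, auto simp: matrix_vector_mult_def)
    then show ?thesis by simp
  qed
  then show ?thesis by (simp add: vec_eq_iff)
qed

lemma matrix_vector_mult_uminus: "A *v (- v) = - (A *v v)" for A :: "real^'n^'m"
  by (metis diff_0 matrix_vector_mult_0_right matrix_vector_mult_diff_distrib)

lemmas matrix_vector_linear_simps = matrix_vector_mult_uminus
  matrix_vector_right_distrib matrix_vector_mult_diff_distrib matrix_vector_mult_scaleR

lemma sym_pos_def_inj:
  assumes "sym_pos_def_on UNIV M" "M *v v = 0"
  shows "v = 0"
  using assms unfolding sym_pos_def_on_def by (metis UNIV_I inner_zero_right less_irrefl)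

lemma invertible_block_diag:
  assumes "\<And>i v. B i *v v = 0 \<Longrightarrow> v = 0"
  shows "invertible (block_diag B)"
proof -
  have "p = 0" if "block_diag B *v p = 0" for p
  proof -
    obtain v where v: "p = col v" by (rule col_cases)
    have "B i *v v i = 0" for i
      using that by (simp add: v block_diag_mult_col vec_eq_iff)
    then have "v i = 0" for i using assms by blast
    then show ?thesis by (simp add: v vec_eq_iff)
  qed
  then show ?thesis
    unfolding invertible_left_inverse matrix_left_invertible_ker by blast
qed

lemma matrix_inv_mult_vec:
  fixes M :: "real^'n^'n"
  assumes "invertible M"
  shows "matrix_inv M *v (M *v v) = v"
proof -
  have "matrix_inv M ** M = mat 1"
    using assms unfolding invertible_def matrix_inv_def by (rule someI2_ex) blast
  then show ?thesis by (simp add: matrix_vector_mul_assoc)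
qed

lemma invertible_block_diag_sym_pos_def:
  assumes "\<forall>i. sym_pos_def_on UNIV (H i)"
  shows "invertible (block_diag H)"
  using assms by (intro invertible_block_diag) (blast dest: sym_pos_def_inj)

text \<open>The blocks of indices that are not edges are identities, so definiteness of the blocks that
  belong to edges is enough.\<close>

lemma invertible_WM:
  assumes "\<forall>l\<in>arcs G. sym_pos_def_on UNIV (W l)"
  shows "invertible (WM G W)"
  unfolding WM_def
  using assms by (intro invertible_block_diag) (auto split: if_splits dest: sym_pos_def_inj)

lemma WM_mult_edge_col: "WM G W *v edge_col G z = edge_col G (\<lambda>l. W l *v z l)"
  unfolding WM_def edge_col_def block_diag_mult_col by (auto simp: col_eq_iff)

lemma WM_edge_space:
  assumes "Z \<in> edge_space G"
  shows "WM G W *v Z \<in> edge_space G"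
proof -
  obtain z where z: "Z = col z" by (rule col_cases)
  then have "Z = edge_col G z"
    using assms by (auto simp: vec_eq_iff edge_space_def)
  then show ?thesis by (simp add: WM_mult_edge_col edge_col_in_edge_space)
qed

lemma edge_space_diff: "Z \<in> edge_space G \<Longrightarrow> Y \<in> edge_space G \<Longrightarrow> Z - Y \<in> edge_space G"
  by (simp add: edge_space_def)

lemma incidence_off_incident: "l \<notin> incident_arcs G i \<Longrightarrow> incidence G $ i $ l = 0"
  by (simp add: incidence_def incident_arcs_def)

lemma Vbar_mult_edge_col:
  "Vbar G *v edge_col G z = col (\<lambda>i. \<Sum>l\<in>incident_arcs G i. incidence G $ i $ l *\<^sub>R z l)"
proof -
  have "(Vbar G *v edge_col G z) $ (i, a) = (\<Sum>l\<in>incident_arcs G i. incidence G $ i $ l * z l $ a)"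
    for i a
  proof -
    have "(Vbar G *v edge_col G z) $ (i, a)
        = (\<Sum>l\<in>UNIV. incidence G $ i $ l * edge_col G z $ (l, a))"
      by (simp add: Vbar_def kron_def matrix_vector_mult_def sum_prod_UNIV mat_def
          sum_kronecker_delta del: edge_col_nth)
    also have "\<dots> = (\<Sum>l\<in>incident_arcs G i. incidence G $ i $ l * z l $ a)"
      by (intro sum.mono_neutral_cong_right)
        (auto simp: incidence_off_incident, auto simp: incident_arcs_def)
    finally show ?thesis .
  qed
  then show ?thesis by (simp add: vec_eq_iff)
qed

text \<open>The transposed incidence matrix takes differences along edges. Loops have to be excluded: the
  incidence matrix gives a loop the entry 1, whereas the difference along it is zero.\<close>

lemma transpose_Vbar_mult_col:
  assumes "loopfree_digraph G"
  shows "transpose (Vbar G) *v col s = edge_col G (\<lambda>l. s (head G l) - s (tail G l))"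
proof -
  have "(transpose (Vbar G) *v col s) $ (l, a) = edge_col G (\<lambda>l. s (head G l) - s (tail G l)) $ (l, a)"
    for l a
  proof -
    have "(transpose (Vbar G) *v col s) $ (l, a) = (\<Sum>i\<in>UNIV. incidence G $ i $ l * s i $ a)"
      by (simp add: Vbar_def kron_def matrix_vector_mult_def sum_prod_UNIV mat_def transpose_def
          sum_kronecker_delta del: sum.delta sum.delta')
    also have "\<dots> = edge_col G (\<lambda>l. s (head G l) - s (tail G l)) $ (l, a)"
    proof (cases "l \<in> arcs G")
      case True
      then have "tail G l \<noteq> head G l"
        using assms by (simp add: loopfree_digraph.no_loops)
      then have "incidence G $ i $ l * s i $ a
          = (if i = head G l then s i $ a else 0) - (if i = tail G l then s i $ a else 0)" for i
        using True by (auto simp: incidence_def in_arcs_def out_arcs_def)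
      then show ?thesis using True by (simp add: sum_subtractf sum.delta')
    next
      case False
      then show ?thesis by (simp add: incidence_def)
    qed
    finally show ?thesis .
  qed
  then show ?thesis by (simp add: vec_eq_iff del: edge_col_nth)
qed

lemma transpose_Vbar_edge_space: "transpose (Vbar G) *v p \<in> edge_space G"
  by (auto simp: edge_space_def matrix_vector_mult_def transpose_def Vbar_def kron_def incidence_def)

lemma LambdaM_mult: "LambdaM \<Gamma> *v x = col (\<lambda>i. constr_mat \<Gamma> i *v block \<Gamma> i x)"
  by (auto simp: vec_eq_iff LambdaM_def block_def matrix_vector_mult_def intro!: sum.cong)

text \<open>Each player evaluates its row of the global constraint residual \<open>\<Lambda> x + V Z - b\<close> from its own
  data and the incident edges, because row \<open>i\<close> of the incidence matrix vanishes off these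
  edges.\<close>

lemma col_local_residual:
  "col (local_residual \<Gamma> G x z) = LambdaM \<Gamma> *v x + Vbar G *v edge_col G z - bbar \<Gamma>"
  by (simp add: LambdaM_mult Vbar_mult_edge_col bbar_def col_add col_diff col_eq_iff
      local_residual_def fun_eq_iff)

lemma player_space_diff:
  "u \<in> player_space \<Gamma> i \<Longrightarrow> v \<in> player_space \<Gamma> i \<Longrightarrow> u - v \<in> player_space \<Gamma> i"
  by (simp add: player_space_def)

lemma block_in_player_space: "block \<Gamma> i x \<in> player_space \<Gamma> i"
  by (simp add: player_space_def block_def)

lemma block_diff: "block \<Gamma> i (x - y) = block \<Gamma> i x - block \<Gamma> i y"
  by (simp add: vec_eq_iff block_def)

lemma block_inner:
  assumes "v \<in> player_space \<Gamma> i"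
  shows "block \<Gamma> i l \<bullet> v = l \<bullet> v"
  using assms by (auto simp: inner_vec_def block_def player_space_def intro!: sum.cong)

lemma block_subst_block:
  assumes "y \<in> player_space \<Gamma> i"
  shows "block \<Gamma> i (subst_block \<Gamma> i y x) = y"
  using assms by (auto simp: vec_eq_iff block_def subst_block_def player_space_def)

lemma subst_block_self [simp]: "subst_block \<Gamma> i (block \<Gamma> i x) x = x"
  by (simp add: vec_eq_iff block_def subst_block_def)

lemma RM_inner:
  assumes "v \<in> player_space \<Gamma> i"
  shows "(RM \<Gamma> R *v u) \<bullet> v = (R i *v block \<Gamma> i u) \<bullet> v"
proof -
  have "(RM \<Gamma> R *v u) $ j * v $ j = (R i *v block \<Gamma> i u) $ j * v $ j" for j
  proof (cases "owner \<Gamma> j = i")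
    case True
    then have "(RM \<Gamma> R *v u) $ j = (R i *v block \<Gamma> i u) $ j"
      by (auto simp: RM_def matrix_vector_mult_def block_def intro!: sum.cong)
    then show ?thesis by simp
  next
    case False
    then show ?thesis using assms by (simp add: player_space_def)
  qed
  then show ?thesis unfolding inner_vec_def inner_real_def by (intro sum.cong refl)
qed

lemma LambdaM_transpose_inner:
  assumes "v \<in> player_space \<Gamma> i"
  shows "(transpose (LambdaM \<Gamma>) *v col q) \<bullet> v = q i \<bullet> (constr_mat \<Gamma> i *v v)"
proof -
  have zero: "block \<Gamma> j v = (if j = i then v else 0)" for j
    using assms by (auto simp: vec_eq_iff block_def player_space_def)
  have "(transpose (LambdaM \<Gamma>) *v col q) \<bullet> v = col q \<bullet> (LambdaM \<Gamma> *v v)"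
    by (simp add: dot_lmul_matrix)
  also have "\<dots> = (\<Sum>j\<in>UNIV. q j \<bullet> (constr_mat \<Gamma> j *v block \<Gamma> j v))"
    by (simp add: LambdaM_mult inner_vec_def sum_prod_UNIV)
  also have "\<dots> = (\<Sum>j\<in>UNIV. if j = i then q i \<bullet> (constr_mat \<Gamma> i *v v) else 0)"
    by (intro sum.cong) (auto simp: zero)
  finally show ?thesis by simp
qed

section \<open>Optimality conditions of the regularized subgame\<close>

text \<open>If the affine bound failed at \<open>y\<close>, then by convexity the violation along the segment from \<open>x\<close>
  to \<open>y\<close> would be at least proportional to the distance from \<open>x\<close>, whereas the allowed error \<open>Q\<close>
  is proportional to its square. This is how the subdifferential of a sum of a convex and a
  quadratic function splits at a minimizer.\<close>

lemma convex_on_lower_bound_absorbs_quadratic: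
  fixes f :: "'a::real_inner \<Rightarrow> real"
  assumes f: "convex_on S f" and "x \<in> S" "y \<in> S"
    and Q: "\<And>t v. Q (t *\<^sub>R v) = t\<^sup>2 * Q v"
    and below: "\<And>y. y \<in> S \<Longrightarrow> f y + Q (y - x) \<ge> f x + g \<bullet> (y - x)"
  shows "f y \<ge> f x + g \<bullet> (y - x)"
proof -
  define D where "D = f y - f x - g \<bullet> (y - x)"
  have key: "0 \<le> D + t * Q (y - x)" if t: "0 < t" "t < 1" for t
  proof -
    let ?p = "(1 - t) *\<^sub>R x + t *\<^sub>R y"
    have p: "?p - x = t *\<^sub>R (y - x)" by (simp add: algebra_simps)
    have "?p \<in> S"
      using convex_on_imp_convex [OF f] assms(2,3) t by (simp add: convex_alt)
    then have "f x + t * (g \<bullet> (y - x)) \<le> f ?p + t\<^sup>2 * Q (y - x)"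
      using below [of ?p] by (simp add: p Q)
    moreover have "f ?p \<le> (1 - t) * f x + t * f y"
      using convex_onD [OF f, of t x y] assms(2,3) t by simp
    ultimately have "0 \<le> t * (D + t * Q (y - x))"
      by (simp add: D_def algebra_simps power2_eq_square)
    then show ?thesis using t by (simp add: zero_le_mult_iff)
  qed
  have "((\<lambda>t. D + t * Q (y - x)) \<longlongrightarrow> D + 0 * Q (y - x)) (at_right 0)"
    by (intro tendsto_intros)
  moreover have "\<forall>\<^sub>F t in at_right 0. 0 \<le> D + t * Q (y - x)"
    unfolding eventually_at_right_field by (rule exI [of _ 1]) (auto intro: key)
  ultimately have "0 \<le> D + 0 * Q (y - x)"
    by (rule tendsto_lowerbound) simp
  then show ?thesis by (simp add: D_def)
qed

text \<open>In an equilibrium every block minimizes the player's cost plus a quadratic and a linear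
  term; the negative gradient of these two terms at the equilibrium is then a subgradient of the
  cost. As costs count as infinite outside the strategy sets, the subdifferential already
  contains the normal cone, so that the whole vector belongs to the pseudo-subdifferential.\<close>

lemma nash_equilibrium_subgradient:
  fixes \<Gamma> :: "('p::finite, 'c::finite, 'm::finite) shared_game"
    and G :: "('p, 'e::finite) pre_digraph"
  assumes reg: "regular_game \<Gamma>"
    and R: "\<forall>i. sym_pos_def_on (player_space \<Gamma> i) (R i)"
    and nash: "nash_equilibrium \<Gamma> (subgame_cost \<Gamma> G R H x z lam) \<xi>"
  shows "\<xi> \<in> strat_prod \<Gamma>"
    and "RM \<Gamma> R *v (x - \<xi>) - transpose (LambdaM \<Gamma>) *v
           (col lam + block_diag H *v (LambdaM \<Gamma> *v x + Vbar G *v edge_col G z - bbar \<Gamma>))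
         \<in> pseudo_subdiff \<Gamma> \<xi>"
proof -
  show strat: "\<xi> \<in> strat_prod \<Gamma>"
    using nash by (simp add: nash_equilibrium_def strat_prod_def)
  define q where "q = (\<lambda>i. lam i + H i *v local_residual \<Gamma> G x z i)"
  define l where "l = RM \<Gamma> R *v (x - \<xi>) - transpose (LambdaM \<Gamma>) *v col q"
  have "block \<Gamma> i l \<in> subdifferential (player_space \<Gamma> i) (strat \<Gamma> i)
       (\<lambda>y. cost \<Gamma> i (subst_block \<Gamma> i y \<xi>)) (block \<Gamma> i \<xi>)" for i
  proof -
    let ?f = "\<lambda>y. cost \<Gamma> i (subst_block \<Gamma> i y \<xi>)"
    let ?\<xi> = "block \<Gamma> i \<xi>"
    let ?P = "player_space \<Gamma> i"
    have \<xi>: "?\<xi> \<in> strat \<Gamma> i" using strat by (simp add: strat_prod_def)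
    have sub: "strat \<Gamma> i \<subseteq> ?P" using reg by (simp add: regular_game_def)
    have convex: "convex_on (strat \<Gamma> i) ?f"
      using reg strat by (simp add: regular_game_def proper_lsc_convex_def strat_prod_def)
    have below: "?f y + 1/2 * ((y - ?\<xi>) \<bullet> (R i *v (y - ?\<xi>)))
        \<ge> ?f ?\<xi> + block \<Gamma> i l \<bullet> (y - ?\<xi>)" if y: "y \<in> strat \<Gamma> i" for y
    proof -
      define d where "d = y - ?\<xi>"
      define e where "e = block \<Gamma> i (\<xi> - x)"
      have dP: "d \<in> ?P" and eP: "e \<in> ?P"
        using y sub \<xi> by (auto simp: d_def e_def intro: player_space_diff block_in_player_space)
      have yP: "block \<Gamma> i (subst_block \<Gamma> i y \<xi>) = y"
        using y sub by (blast intro: block_subst_block)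
      have de: "block \<Gamma> i (subst_block \<Gamma> i y \<xi> - x) = d + e"
        by (simp add: block_diff yP d_def e_def)
      have sym: "e \<bullet> (R i *v d) = (R i *v e) \<bullet> d"
        using R dP eP by (simp add: sym_pos_def_on_def)
      have neg: "block \<Gamma> i (x - \<xi>) = - e"
        by (simp add: e_def block_diff)
      have "block \<Gamma> i l \<bullet> d = - ((R i *v e) \<bullet> d) - q i \<bullet> (constr_mat \<Gamma> i *v d)"
        unfolding block_inner [OF dP] l_def inner_diff_left RM_inner [OF dP]
          LambdaM_transpose_inner [OF dP] neg
        by (simp add: matrix_vector_mult_uminus)
      moreover have "?f ?\<xi> + 1/2 * (e \<bullet> (R i *v e)) + q i \<bullet> (constr_mat \<Gamma> i *v ?\<xi>)
          \<le> ?f y + 1/2 * ((d + e) \<bullet> (R i *v (d + e))) + q i \<bullet> (constr_mat \<Gamma> i *v y)"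
      proof -
        have "subgame_cost \<Gamma> G R H x z lam i \<xi>
            \<le> subgame_cost \<Gamma> G R H x z lam i (subst_block \<Gamma> i y \<xi>)"
          using nash y unfolding nash_equilibrium_def by blast
        then show ?thesis
          by (simp add: subgame_cost_def de yP q_def flip: e_def)
      qed
      moreover have "y = ?\<xi> + d" by (simp add: d_def)
      ultimately show ?thesis
        using sym by (simp add: matrix_vector_right_distrib inner_add_left inner_add_right
            inner_commute [of d "R i *v e"] add_divide_distrib flip: d_def)
    qed
    have "?f y \<ge> ?f ?\<xi> + block \<Gamma> i l \<bullet> (y - ?\<xi>)" if y: "y \<in> strat \<Gamma> i" for y
      by (rule convex_on_lower_bound_absorbs_quadratic
            [OF convex \<xi> y, where Q = "\<lambda>v. 1/2 * (v \<bullet> (R i *v v))"])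
        (use below in \<open>auto simp: matrix_vector_mult_scaleR power2_eq_square\<close>)
    then show ?thesis
      using \<xi> by (simp add: subdifferential_def block_in_player_space)
  qed
  then have "l \<in> pseudo_subdiff \<Gamma> \<xi>" by (simp add: pseudo_subdiff_def)
  moreover have "col q = col lam
      + block_diag H *v (LambdaM \<Gamma> *v x + Vbar G *v edge_col G z - bbar \<Gamma>)"
    by (simp add: q_def col_add block_diag_mult_col flip: col_local_residual)
  ultimately show "RM \<Gamma> R *v (x - \<xi>) - transpose (LambdaM \<Gamma>) *v
           (col lam + block_diag H *v (LambdaM \<Gamma> *v x + Vbar G *v edge_col G z - bbar \<Gamma>))
         \<in> pseudo_subdiff \<Gamma> \<xi>"
    by (simp add: l_def)
qed

section \<open>Eliminating the auxiliary variables of the proximal step\<close>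

text \<open>Here \<open>\<xi>\<close> is the strategy part of the new state, and the other three parts are what rows
  two, three and four of the proximal inclusion then force. The argument of the transposed
  incidence matrix equals \<open>\<eta>' + \<eta>' - \<eta> - \<theta>\<close> for the new multiplier \<open>\<eta>'\<close>.\<close>

fun aug_step ::
    "('p::finite, 'c::finite, 'm::finite) shared_game \<Rightarrow> ('p, 'e::finite) pre_digraph \<Rightarrow>
     ('p \<Rightarrow> real^'m^'m) \<Rightarrow> ('e \<Rightarrow> real^'m^'m) \<Rightarrow>
     ('p, 'c, 'e, 'm) aug_state \<Rightarrow> real^'c \<Rightarrow> ('p, 'c, 'e, 'm) aug_state" where
  "aug_step \<Gamma> G H W (x, \<eta>, Z, \<theta>) \<xi> =
     (let r = 2 *\<^sub>R (LambdaM \<Gamma> *v \<xi>) - LambdaM \<Gamma> *v x + Vbar G *v Z - bbar \<Gamma>;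
          Y = Z - WM G W *v (transpose (Vbar G) *v (\<eta> - \<theta> + block_diag H *v r))
      in (\<xi>, \<eta> + (1/2) *\<^sub>R (block_diag H *v r), Y,
          \<theta> - (1/2) *\<^sub>R (block_diag H *v (r - 2 *\<^sub>R (Vbar G *v (Z - Y))))))"

lemma aug_step_in_aug_space:
  assumes "w \<in> aug_space G"
  shows "aug_step \<Gamma> G H W w \<xi> \<in> aug_space G"
  using assms
  by (cases w) (auto simp: aug_space_def Let_def simp del: transpose_matrix_vector
      intro!: edge_space_diff WM_edge_space transpose_Vbar_edge_space)

text \<open>The last hypothesis is the first row of the inclusion, with zero as the element of the normal
  cone. It involves the old multipliers only, because the new ones enter the preconditioner and
  the operator with the same coefficients.\<close>

lemma precond_aug_step_in_aug_op:
  assumes H: "invertible (block_diag H)" and W: "invertible (WM G W)"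
    and "\<xi> \<in> strat_prod \<Gamma>"
    and sub: "RM \<Gamma> R *v (x - \<xi>) - transpose (LambdaM \<Gamma>) *v (\<eta> - \<theta>) \<in> pseudo_subdiff \<Gamma> \<xi>"
  shows "precond \<Gamma> G R H W ((x, \<eta>, Z, \<theta>) - aug_step \<Gamma> G H W (x, \<eta>, Z, \<theta>) \<xi>)
         \<in> aug_op \<Gamma> G (aug_step \<Gamma> G H W (x, \<eta>, Z, \<theta>) \<xi>)"
proof -
  define r where "r = 2 *\<^sub>R (LambdaM \<Gamma> *v \<xi>) - LambdaM \<Gamma> *v x + Vbar G *v Z - bbar \<Gamma>"
  define s where "s = \<eta> - \<theta> + block_diag H *v r"
  define Y where "Y = Z - WM G W *v (transpose (Vbar G) *v s)"
  \<comment> \<open>The factor 1/2 inverts the diagonal blocks \<open>2 H\<^sup>-\<^sup>1\<close> of the preconditioner.\<close>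
  define \<eta>' where "\<eta>' = \<eta> + (1/2) *\<^sub>R (block_diag H *v r)"
  define \<theta>' where "\<theta>' = \<theta> - (1/2) *\<^sub>R (block_diag H *v (r - 2 *\<^sub>R (Vbar G *v (Z - Y))))"
  have step: "aug_step \<Gamma> G H W (x, \<eta>, Z, \<theta>) \<xi> = (\<xi>, \<eta>', Y, \<theta>')"
    by (simp add: Let_def \<eta>'_def \<theta>'_def Y_def s_def r_def)
  have \<eta>: "2 *\<^sub>R (matrix_inv (block_diag H) *v (\<eta> - \<eta>')) = - r"
  proof -
    have "\<eta> - \<eta>' = block_diag H *v ((- 1/2) *\<^sub>R r)"
      by (simp only: \<eta>'_def matrix_vector_mult_scaleR) simp
    then show ?thesis by (simp add: matrix_inv_mult_vec [OF H])
  qed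
  have \<theta>: "2 *\<^sub>R (matrix_inv (block_diag H) *v (\<theta> - \<theta>')) = r - 2 *\<^sub>R (Vbar G *v (Z - Y))"
  proof -
    have "\<theta> - \<theta>' = block_diag H *v ((1/2) *\<^sub>R (r - 2 *\<^sub>R (Vbar G *v (Z - Y))))"
      by (simp only: \<theta>'_def matrix_vector_mult_scaleR) simp
    then show ?thesis by (simp add: matrix_inv_mult_vec [OF H])
  qed
  have Y: "matrix_inv (WM G W) *v (Z - Y) = transpose (Vbar G) *v s"
    by (simp add: Y_def matrix_inv_mult_vec [OF W])
  have "2 *\<^sub>R \<eta>' = 2 *\<^sub>R \<eta> + block_diag H *v r"
    by (simp add: \<eta>'_def algebra_simps)
  then have s: "s = (\<eta>' - \<theta>') - (\<eta> - \<eta>') - (\<theta> - \<theta>')"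
    by (simp add: s_def algebra_simps scaleR_2)
  have zero: "0 \<in> normal_cone (strat_prod \<Gamma>) \<xi>"
    using assms by (simp add: normal_cone_def)
  show ?thesis
    unfolding step minus_prod_def fst_conv snd_conv precond.simps aug_op.simps \<eta> \<theta> Y
  proof (intro CollectI exI conjI)
    show "0 \<in> normal_cone (strat_prod \<Gamma>) \<xi>" by (rule zero)
    show "RM \<Gamma> R *v (x - \<xi>) - transpose (LambdaM \<Gamma>) *v (\<eta> - \<theta>) \<in> pseudo_subdiff \<Gamma> \<xi>" by (rule sub)
    show "(RM \<Gamma> R *v (x - \<xi>) - transpose (LambdaM \<Gamma>) *v (\<eta> - \<eta>') + transpose (LambdaM \<Gamma>) *v (\<theta> - \<theta>'),
        - (LambdaM \<Gamma> *v (x - \<xi>)) + - r + Vbar G *v (Z - Y),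
        transpose (Vbar G) *v (\<eta> - \<eta>') + transpose (Vbar G) *v s + transpose (Vbar G) *v (\<theta> - \<theta>'),
        LambdaM \<Gamma> *v (x - \<xi>) + Vbar G *v (Z - Y) + (r - 2 *\<^sub>R (Vbar G *v (Z - Y))))
      = (transpose (LambdaM \<Gamma>) *v \<eta>' - transpose (LambdaM \<Gamma>) *v \<theta>'
           + (0 + (RM \<Gamma> R *v (x - \<xi>) - transpose (LambdaM \<Gamma>) *v (\<eta> - \<theta>))),
        - (LambdaM \<Gamma> *v \<xi>) - Vbar G *v Y + bbar \<Gamma>,
        transpose (Vbar G) *v \<eta>' - transpose (Vbar G) *v \<theta>',
        LambdaM \<Gamma> *v \<xi> + Vbar G *v Y - bbar \<Gamma>)"
      unfolding s r_def matrix_vector_linear_simps prod.inject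
      by (simp add: vec_eq_iff algebra_simps del: transpose_matrix_vector)
  qed
qed

text \<open>The state enters \<open>aug_step\<close> additively, so it drops out of the difference of two values, which
  is a fixed linear map applied to \<open>\<xi> - \<zeta>\<close>. The constant therefore does not depend on the
  iteration.\<close>

lemma aug_step_lipschitz:
  fixes \<Gamma> :: "('p::finite, 'c::finite, 'm::finite) shared_game"
    and G :: "('p, 'e::finite) pre_digraph"
  shows "\<exists>C\<ge>0. \<forall>w \<xi> \<zeta>. norm (aug_step \<Gamma> G H W w \<xi> - aug_step \<Gamma> G H W w \<zeta>) \<le> C * norm (\<xi> - \<zeta>)"
proof -
  \<comment> \<open>\<open>D\<close> is the derivative of \<open>aug_step\<close> in its last argument, \<open>h\<close> and \<open>y\<close> its multiplier
    and edge components.\<close>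
  define h where "h = (\<lambda>d. block_diag H *v (LambdaM \<Gamma> *v d))"
  define y where "y = (\<lambda>d. (-2) *\<^sub>R (WM G W *v (transpose (Vbar G) *v h d)))"
  define D where "D = (\<lambda>d. (d, h d, y d, - (h d + block_diag H *v (Vbar G *v y d))))"
  have h: "bounded_linear h"
    unfolding h_def
    by (intro bounded_linear_compose [OF matrix_vector_mul_bounded_linear]
        matrix_vector_mul_bounded_linear)
  have y: "bounded_linear y"
    unfolding y_def
    by (intro bounded_linear_const_scaleR bounded_linear_compose [OF matrix_vector_mul_bounded_linear] h)
  have "bounded_linear D"
    unfolding D_def
    by (intro bounded_linear_Pair bounded_linear_ident bounded_linear_minus bounded_linear_add
        bounded_linear_compose [OF matrix_vector_mul_bounded_linear] h y)
  then obtain C where C: "C > 0" "\<And>d. norm (D d) \<le> norm d * C"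
    using bounded_linear.pos_bounded by blast
  have "aug_step \<Gamma> G H W w \<xi> - aug_step \<Gamma> G H W w \<zeta> = D (\<xi> - \<zeta>)" for w \<xi> \<zeta>
  proof (cases w)
    case (fields x \<eta> Z \<theta>)
    show ?thesis
      unfolding fields D_def y_def h_def aug_step.simps Let_def minus_prod_def fst_conv snd_conv
        matrix_vector_linear_simps prod.inject
      by (simp add: vec_eq_iff algebra_simps del: transpose_matrix_vector)
  qed
  with C show ?thesis by (intro exI [of _ C]) (auto simp: mult.commute)
qed

text \<open>The two multipliers of the augmented state matter only through the combination \<open>p\<close>: its
  update involves \<open>\<eta>\<close> and \<open>\<theta>\<close> through \<open>p\<close> alone, since the change of the edge variables in
  \<open>\<theta>\<close> is compensated by the change of \<open>H(\<Lambda> x + V Z - b)\<close>. The point \<open>\<xi>\<close> is arbitrary here, which is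
  what makes inexact equilibria admissible.\<close>

lemma relaxed_aug_step:
  assumes next_state: "(x', \<eta>', Z', \<theta>')
      = (x, \<eta>, Z, \<theta>) + \<rho> *\<^sub>R (aug_step \<Gamma> G H W (x, \<eta>, Z, \<theta>) \<xi> - (x, \<eta>, Z, \<theta>))"
    and p: "p = \<eta> - \<theta> - block_diag H *v (LambdaM \<Gamma> *v x + Vbar G *v Z - bbar \<Gamma>)"
    and u: "u = block_diag H *v (LambdaM \<Gamma> *v \<xi> + Vbar G *v Z - bbar \<Gamma>)"
  shows "x' = x + \<rho> *\<^sub>R (\<xi> - x)"
    and "Z' = Z - \<rho> *\<^sub>R (WM G W *v (transpose (Vbar G) *v (p + 2 *\<^sub>R u)))"
    and "\<eta>' - \<theta>' - block_diag H *v (LambdaM \<Gamma> *v x' + Vbar G *v Z' - bbar \<Gamma>) = p + \<rho> *\<^sub>R u"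
proof -
  define r where "r = 2 *\<^sub>R (LambdaM \<Gamma> *v \<xi>) - LambdaM \<Gamma> *v x + Vbar G *v Z - bbar \<Gamma>"
  define Y where "Y = Z - WM G W *v (transpose (Vbar G) *v (\<eta> - \<theta> + block_diag H *v r))"
  have step: "aug_step \<Gamma> G H W (x, \<eta>, Z, \<theta>) \<xi> = (\<xi>, \<eta> + (1/2) *\<^sub>R (block_diag H *v r), Y,
      \<theta> - (1/2) *\<^sub>R (block_diag H *v (r - 2 *\<^sub>R (Vbar G *v (Z - Y)))))"
    by (simp add: Let_def Y_def r_def)
  show x': "x' = x + \<rho> *\<^sub>R (\<xi> - x)"
    using next_state unfolding step by simp
  have Z': "Z' = Z + \<rho> *\<^sub>R (Y - Z)"
    using next_state unfolding step by simp
  have s: "\<eta> - \<theta> + block_diag H *v r = p + 2 *\<^sub>R u"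
    unfolding p u r_def matrix_vector_linear_simps by (simp add: vec_eq_iff algebra_simps)
  show "Z' = Z - \<rho> *\<^sub>R (WM G W *v (transpose (Vbar G) *v (p + 2 *\<^sub>R u)))"
    by (simp add: Z' Y_def s)
  have \<eta>': "\<eta>' = \<eta> + \<rho> *\<^sub>R ((1/2) *\<^sub>R (block_diag H *v r))"
    and \<theta>': "\<theta>' = \<theta> - \<rho> *\<^sub>R ((1/2) *\<^sub>R (block_diag H *v (r - 2 *\<^sub>R (Vbar G *v (Z - Y)))))"
    using next_state unfolding step by simp_all
  show "\<eta>' - \<theta>' - block_diag H *v (LambdaM \<Gamma> *v x' + Vbar G *v Z' - bbar \<Gamma>) = p + \<rho> *\<^sub>R u"
    unfolding \<eta>' \<theta>' x' Z' p u r_def matrix_vector_linear_simps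
    by (simp add: vec_eq_iff algebra_simps)
qed

section \<open>The algorithm as a relaxed inexact proximal point iteration\<close>

text \<open>The weights in \<open>s\<close> are chosen such that \<open>\<rho>\<close> cancels after inserting the multiplier update: \<open>s\<close>
  is the old multiplier plus twice the scaled residual. In this form the edge update coincides
  with the one of \<open>relaxed_aug_step\<close>.\<close>

lemma algorithm_update_stacked:
  fixes \<Gamma> :: "('p::finite, 'c::finite, 'm::finite) shared_game"
    and G :: "('p, 'e::finite) pre_digraph"
  assumes G: "loopfree_digraph G" and "\<rho> \<noteq> 0"
    and lam: "\<And>i. lam' i = lam i + \<rho> *\<^sub>R (H i *v local_residual \<Gamma> G \<xi> z i)"
    and s: "\<And>i. s i = (1 / \<rho>) *\<^sub>R lam' i + ((\<rho> - 1) / \<rho>) *\<^sub>R lam i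
                      + H i *v local_residual \<Gamma> G \<xi> z i"
    and z: "\<And>l. l \<in> arcs G \<Longrightarrow> z' l = z l - \<rho> *\<^sub>R (W l *v (s (head G l) - s (tail G l)))"
    and u: "u = block_diag H *v (LambdaM \<Gamma> *v \<xi> + Vbar G *v edge_col G z - bbar \<Gamma>)"
  shows "col lam' = col lam + \<rho> *\<^sub>R u"
    and "edge_col G z' = edge_col G z
           - \<rho> *\<^sub>R (WM G W *v (transpose (Vbar G) *v (col lam + 2 *\<^sub>R u)))"
proof -
  have u': "u = col (\<lambda>i. H i *v local_residual \<Gamma> G \<xi> z i)"
    by (simp add: u block_diag_mult_col flip: col_local_residual)
  show "col lam' = col lam + \<rho> *\<^sub>R u"
    by (simp add: u' col_add col_scaleR col_eq_iff fun_eq_iff lam)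
  have "s i = lam i + 2 *\<^sub>R (H i *v local_residual \<Gamma> G \<xi> z i)" for i
    using \<open>\<rho> \<noteq> 0\<close> by (simp add: s lam vec_eq_iff field_simps)
  then have "col lam + 2 *\<^sub>R u = col s"
    by (simp add: u' col_add col_scaleR col_eq_iff fun_eq_iff)
  then show "edge_col G z' = edge_col G z
           - \<rho> *\<^sub>R (WM G W *v (transpose (Vbar G) *v (col lam + 2 *\<^sub>R u)))"
    by (simp only: transpose_Vbar_mult_col [OF G] WM_mult_edge_col) (simp add: vec_eq_iff z)
qed

theorem theorem4:
  fixes \<Gamma> :: "('p::finite, 'c::finite, 'm::finite) shared_game"
    and G :: "('p, 'e::finite) pre_digraph"
    and R :: "'p \<Rightarrow> real^'c^'c" and H :: "'p \<Rightarrow> real^'m^'m" and W :: "'e \<Rightarrow> real^'m^'m"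
    and \<rho> :: real and \<mu> :: "nat \<Rightarrow> real"
    and x :: "nat \<Rightarrow> real^'c" and z :: "nat \<Rightarrow> 'e \<Rightarrow> real^'m" and lam :: "nat \<Rightarrow> 'p \<Rightarrow> real^'m"
  assumes "regular_game \<Gamma>"
    and "\<exists>x. gvi_solution \<Gamma> x"
    and "comm_graph G"
    and "1 \<le> \<rho>" and "\<rho> < 2"
    and "\<forall>k. \<mu> k \<ge> 0" and "summable (\<lambda>k. \<mu> (Suc k))"
    and "\<forall>i. sym_pos_def_on (player_space \<Gamma> i) (R i)"
    and "\<forall>i. sym_pos_def_on UNIV (H i)"
    and "\<forall>l\<in>arcs G. sym_pos_def_on UNIV (W l)"
    and "generated_by_algorithm \<Gamma> G R H W \<rho> \<mu> x z lam"
  shows "\<exists>\<nu> w what wtil x' \<eta> Z' \<theta>.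
     (\<forall>k. \<nu> k \<ge> 0) \<and> summable (\<lambda>k. \<nu> (Suc k)) \<and>
     (\<forall>k. w k = (x' k, \<eta> k, Z' k, \<theta> k)) \<and>
     inexact_ppp \<Gamma> G R H W \<rho> \<nu> w what wtil \<and>
     x' 0 = x 0 \<and>
     \<eta> 0 = col (lam 0) + block_diag H *v
       (LambdaM \<Gamma> *v x 0 + Vbar G *v edge_col G (z 0) - bbar \<Gamma>) \<and>
     Z' 0 = edge_col G (z 0) \<and>
     \<theta> 0 = 0 \<and>
     (\<forall>k. x k = x' k \<and> edge_col G (z k) = Z' k \<and>
        col (lam k) = \<eta> k - \<theta> k - block_diag H *v
          (LambdaM \<Gamma> *v x' k + Vbar G *v Z' k - bbar \<Gamma>))"
proof -
  have loopfree: "loopfree_digraph G"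
    using assms(3) by (simp add: comm_graph_def)
  obtain xhat xtil s where
    nash: "\<And>k. nash_equilibrium \<Gamma> (subgame_cost \<Gamma> G R H (x k) (z k) (lam k)) (xhat k)"
    and close: "\<And>k. norm (xtil k - xhat k) \<le> \<mu> k"
    and x: "\<And>k. x (Suc k) = x k + \<rho> *\<^sub>R (xtil k - x k)"
    and lam: "\<And>k i. lam (Suc k) i = lam k i + \<rho> *\<^sub>R (H i *v local_residual \<Gamma> G (xtil k) (z k) i)"
    and s: "\<And>k i. s k i = (1 / \<rho>) *\<^sub>R lam (Suc k) i + ((\<rho> - 1) / \<rho>) *\<^sub>R lam k i
                      + H i *v local_residual \<Gamma> G (xtil k) (z k) i"
    and z: "\<And>k l. l \<in> arcs G \<Longrightarrow>
              z (Suc k) l = z k l - \<rho> *\<^sub>R (W l *v (s k (head G l) - s k (tail G l)))"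
    using assms(11) unfolding generated_by_algorithm_def by metis
  obtain C where "C \<ge> 0" and lipschitz:
    "\<And>w \<xi> \<zeta>. norm (aug_step \<Gamma> G H W w \<xi> - aug_step \<Gamma> G H W w \<zeta>) \<le> C * norm (\<xi> - \<zeta>)"
    using aug_step_lipschitz [of \<Gamma> G H W] by blast
  define \<eta>\<^sub>0 where "\<eta>\<^sub>0 = col (lam 0)
    + block_diag H *v (LambdaM \<Gamma> *v x 0 + Vbar G *v edge_col G (z 0) - bbar \<Gamma>)"
  \<comment> \<open>The augmented iteration is driven by the approximate equilibria; the sequences of the
    algorithm are recovered from it by induction.\<close>
  define w where "w = rec_nat (x 0, \<eta>\<^sub>0, edge_col G (z 0), 0)
    (\<lambda>k w. w + \<rho> *\<^sub>R (aug_step \<Gamma> G H W w (xtil k) - w))"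
  have w_0: "w 0 = (x 0, \<eta>\<^sub>0, edge_col G (z 0), 0)"
    and w_Suc: "\<And>k. w (Suc k) = w k + \<rho> *\<^sub>R (aug_step \<Gamma> G H W (w k) (xtil k) - w k)"
    by (simp_all add: w_def)
  define \<eta> where "\<eta> k = fst (snd (w k))" for k
  define \<theta> where "\<theta> k = snd (snd (snd (w k)))" for k
  have invariant: "w k = (x k, \<eta> k, edge_col G (z k), \<theta> k) \<and>
      col (lam k) = \<eta> k - \<theta> k
        - block_diag H *v (LambdaM \<Gamma> *v x k + Vbar G *v edge_col G (z k) - bbar \<Gamma>)" for k
  proof (induction k)
    case 0
    then show ?case by (simp add: w_0 \<eta>_def \<theta>_def \<eta>\<^sub>0_def)
  next
    case (Suc k)
    obtain x' Z' where w': "w (Suc k) = (x', \<eta> (Suc k), Z', \<theta> (Suc k))"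
      by (cases "w (Suc k)") (simp add: \<eta>_def \<theta>_def)
    define u where
      "u = block_diag H *v (LambdaM \<Gamma> *v xtil k + Vbar G *v edge_col G (z k) - bbar \<Gamma>)"
    have "(x', \<eta> (Suc k), Z', \<theta> (Suc k)) = (x k, \<eta> k, edge_col G (z k), \<theta> k)
        + \<rho> *\<^sub>R (aug_step \<Gamma> G H W (x k, \<eta> k, edge_col G (z k), \<theta> k) (xtil k)
                  - (x k, \<eta> k, edge_col G (z k), \<theta> k))"
      using w_Suc [of k] Suc.IH w' by metis
    note relaxed = relaxed_aug_step [OF this conjunct2 [OF Suc.IH] u_def]
    have "\<rho> \<noteq> 0" using assms(4) by simp
    note update = algorithm_update_stacked
      [where \<Gamma> = \<Gamma> and W = W, OF loopfree this lam s z u_def]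
    show ?case
      using relaxed update w' by (simp add: x)
  qed
  define what where "what k = aug_step \<Gamma> G H W (w k) (xhat k)" for k
  define wtil where "wtil k = aug_step \<Gamma> G H W (w k) (xtil k)" for k
  have "precond \<Gamma> G R H W (w k - what k) \<in> aug_op \<Gamma> G (what k)" for k
  proof -
    have multiplier: "\<eta> k - \<theta> k = col (lam k)
        + block_diag H *v (LambdaM \<Gamma> *v x k + Vbar G *v edge_col G (z k) - bbar \<Gamma>)"
      using invariant [of k] by (simp add: algebra_simps)
    have "w k = (x k, \<eta> k, edge_col G (z k), \<theta> k)"
      using invariant by blast
    then show ?thesis
      using precond_aug_step_in_aug_op [OF invertible_block_diag_sym_pos_def [OF assms(9)]
          invertible_WM [OF assms(10)], of "xhat k" \<Gamma> R "x k" "\<eta> k" "\<theta> k" "edge_col G (z k)"]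
        nash_equilibrium_subgradient [OF assms(1,8) nash [of k]]
      by (simp only: what_def multiplier)
  qed
  moreover have "w k \<in> aug_space G" for k
    using invariant [of k] by (simp add: aug_space_def edge_col_in_edge_space)
  moreover have "what k \<in> aug_space G" "wtil k \<in> aug_space G" for k
    using \<open>\<And>k. w k \<in> aug_space G\<close> by (simp_all add: what_def wtil_def aug_step_in_aug_space)
  moreover have "norm (what k - wtil k) \<le> C * \<mu> k" for k
  proof -
    have "norm (what k - wtil k) \<le> C * norm (xhat k - xtil k)"
      unfolding what_def wtil_def by (rule lipschitz)
    also have "\<dots> \<le> C * \<mu> k"
      using close [of k] \<open>C \<ge> 0\<close> by (simp add: norm_minus_commute mult_left_mono)
    finally show ?thesis .
  qed
  ultimately have "inexact_ppp \<Gamma> G R H W \<rho> (\<lambda>k. C * \<mu> k) w what wtil"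
    by (simp add: inexact_ppp_def w_Suc wtil_def)
  moreover have "\<forall>k. C * \<mu> k \<ge> 0" "summable (\<lambda>k. C * \<mu> (Suc k))"
    using \<open>C \<ge> 0\<close> assms(6,7) by (simp_all add: summable_mult)
  moreover have "\<eta> 0 = \<eta>\<^sub>0" "\<theta> 0 = 0"
    by (simp_all add: \<eta>_def \<theta>_def w_0)
  ultimately show ?thesis
    using invariant unfolding \<eta>\<^sub>0_def
    by (intro exI [of _ "\<lambda>k. C * \<mu> k"] exI [of _ w] exI [of _ what] exI [of _ wtil] exI [of _ x]
        exI [of _ \<eta>] exI [of _ "\<lambda>k. edge_col G (z k)"] exI [of _ \<theta>]) simp
qed

end
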